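(* Let $k\ge1$ and let $A$ be a $k\times k$ strictly upper triangular matrix of integers. Let $P_A$ be the set of integer sequences $\lambda=(\lambda_1,\ldots,\lambda_k)$ satisfying $\lambda_i \ge \sum_{j=i+1}^{k} A[i,j]\lambda_j$ for $1\le i\le k$, and let $P_A(n,k)$ be the set of elements of $P_A$ of weight $\lambda_1+\cdots+\lambda_k=n$. If every $\lambda\in P_A$ has all entries nonnegative, then \[\sum_{n=0}^{\infty}|P_A(n,k)|\,q^n=\prod_{i=1}^{k}\frac{1}{1-q^{b_i}},\] where $B=(I-A)^{-1}$ and $b_i=\sum_{j} B[j,i]$ is the $i$-th column sum of $B$.
   Context: A strictly upper triangular matrix $A$ has $A[i,j]=0$ for $i\ge j$. $I$ is the $k\times k$ identity matrix. The weight of a sequence is the sum of its entries. *)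

theory Defs
  imports
    Jordan_Normal_Form.Determinant
    "HOL-Computational_Algebra.Formal_Power_Series"
begin

(* Rows, columns and sequence entries are indexed from 0, following Jordan_Normal_Form. *)

definition strictly_upper_triangular :: "'a::zero mat \<Rightarrow> bool" where
  "strictly_upper_triangular A \<longleftrightarrow>
     (\<forall>i < dim_row A. \<forall>j < dim_col A. j \<le> i \<longrightarrow> A $$ (i, j) = 0)"

definition inv_mat :: "'a::comm_ring_1 mat \<Rightarrow> 'a mat" where
  "inv_mat M = (THE B. B \<in> carrier_mat (dim_col M) (dim_row M) \<and>
                       inverts_mat M B \<and> inverts_mat B M)"

definition col_sum :: "'a::comm_monoid_add mat \<Rightarrow> nat \<Rightarrow> 'a" where
  "col_sum B i = (\<Sum>j<dim_row B. B $$ (j, i))"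

definition weight :: "'a::comm_monoid_add vec \<Rightarrow> 'a" where
  "weight v = (\<Sum>i<dim_vec v. v $ i)"

definition P_set :: "nat \<Rightarrow> int mat \<Rightarrow> int vec set" where
  "P_set k A = {v \<in> carrier_vec k. \<forall>i<k. v $ i \<ge> (\<Sum>j\<in>{i<..<k}. A $$ (i, j) * v $ j)}"

definition P_weight_set :: "nat \<Rightarrow> int mat \<Rightarrow> nat \<Rightarrow> int vec set" where
  "P_weight_set k A n = {v \<in> P_set k A. weight v = int n}"

lemma inv_mat_eqI:
  fixes M :: "'a::comm_ring_1 mat"
  assumes M: "M \<in> carrier_mat n n" and B: "B \<in> carrier_mat n n"
    and MB: "M * B = 1\<^sub>m n" and BM: "B * M = 1\<^sub>m n"
  shows "inv_mat M = B"
  unfolding inv_mat_def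
proof (rule the_equality)
  show "B \<in> carrier_mat (dim_col M) (dim_row M) \<and> inverts_mat M B \<and> inverts_mat B M"
    using assms by (auto simp: inverts_mat_def)
next
  fix C assume "C \<in> carrier_mat (dim_col M) (dim_row M) \<and> inverts_mat M C \<and> inverts_mat C M"
  then have C: "C \<in> carrier_mat n n" and MC: "M * C = 1\<^sub>m n"
    using M by (auto simp: inverts_mat_def)
  have "C = (B * M) * C" using BM C by simp
  also have "\<dots> = B * (M * C)" using B M C by (rule assoc_mult_mat)
  finally show "C = B" using MC B by simp
qed

(* The inverse below exists already over the integers, so inv_mat is never applied
   outside its domain. *)
lemma inv_mat_one_minus_strictly_upper_triangular:
  fixes A :: "'a::comm_ring_1 mat"
  assumes A: "A \<in> carrier_mat n n" and ut: "strictly_upper_triangular A"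
  shows "inv_mat (1\<^sub>m n - A) \<in> carrier_mat n n"
    and "(1\<^sub>m n - A) * inv_mat (1\<^sub>m n - A) = 1\<^sub>m n"
    and "inv_mat (1\<^sub>m n - A) * (1\<^sub>m n - A) = 1\<^sub>m n"
proof -
  let ?M = "1\<^sub>m n - A"
  have M: "?M \<in> carrier_mat n n" using A by (rule minus_carrier_mat)
  have "upper_triangular ?M" using A ut
    by (auto simp: upper_triangular_def strictly_upper_triangular_def)
  then have "det ?M = prod_list (diag_mat ?M)" using M by (rule det_upper_triangular)
  also have "diag_mat ?M = map (\<lambda>_. 1) [0..<n]"
    using A ut by (auto simp: diag_mat_def strictly_upper_triangular_def)
  also have "prod_list \<dots> = (1 :: 'a)" by (simp add: map_replicate_const)
  finally have det: "det ?M = 1" .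
  note adj = adj_mat[OF M]
  have 1: "?M * adj_mat ?M = 1\<^sub>m n" "adj_mat ?M * ?M = 1\<^sub>m n"
    using adj det by auto
  have "inv_mat ?M = adj_mat ?M" by (rule inv_mat_eqI[OF M adj(1) 1])
  then show "inv_mat ?M \<in> carrier_mat n n" "?M * inv_mat ?M = 1\<^sub>m n" "inv_mat ?M * ?M = 1\<^sub>m n"
    using adj(1) 1 by simp_all
qed

end

(* The map v \<mapsto> (I - A) v identifies P_A with the vectors of natural numbers, with inverse
   u \<mapsto> B u, and the weight of B u is the sum of the b_i u_i. Hence |P_A(n,k)| is the number of
   solutions of \<Sum> b_i u_i = n in natural numbers, whose generating function is the claimed product.
   The nonnegativity hypothesis enters only to give b_i > 0: the i-th column of B is B e_i, a
   nonzero element of P_A. *)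
theory Submission
  imports Defs
begin

text \<open>Fixing the value 0 outside \<open>I\<close> makes a function the same thing as its
  restriction to \<open>I\<close>, so cardinalities of these sets count solutions without
  repetition.\<close>

definition weighted_solutions :: "('i \<Rightarrow> nat) \<Rightarrow> 'i set \<Rightarrow> nat \<Rightarrow> ('i \<Rightarrow> nat) set" where
  "weighted_solutions b I n = {u. (\<forall>i. i \<notin> I \<longrightarrow> u i = 0) \<and> (\<Sum>i\<in>I. b i * u i) = n}"

text \<open>Positive coefficients bound every entry of a solution by \<open>n\<close>. The counting
  below rests on this, since \<open>card\<close> is 0 on infinite sets.\<close>

lemma finite_weighted_solutions:
  assumes "finite I" and pos: "\<And>i. i \<in> I \<Longrightarrow> b i > 0"
  shows "finite (weighted_solutions b I n)"
proof (rule finite_subset)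
  show "weighted_solutions b I n \<subseteq> {u. \<forall>i. (i \<in> I \<longrightarrow> u i \<in> {..n}) \<and> (i \<notin> I \<longrightarrow> u i = 0)}"
  proof safe
    fix u i assume u: "u \<in> weighted_solutions b I n" and i: "i \<in> I"
    have "u i \<le> b i * u i" using pos[OF i] by simp
    also have "\<dots> \<le> (\<Sum>i\<in>I. b i * u i)" using i \<open>finite I\<close> by (intro member_le_sum) auto
    also have "\<dots> = n" using u by (simp add: weighted_solutions_def)
    finally show "u i \<le> n" .
  qed (auto simp: weighted_solutions_def)
  show "finite {u. \<forall>i. (i \<in> I \<longrightarrow> u i \<in> {..n}) \<and> (i \<notin> I \<longrightarrow> u i = 0)}"
    using \<open>finite I\<close> by (intro finite_set_of_finite_funs) auto
qed

text \<open>Solutions either vanish at \<open>x\<close>, or arise from a solution of smaller weight by raising the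
  entry at \<open>x\<close> by one.\<close>

lemma weighted_solutions_insert:
  assumes "finite F" and x: "x \<notin> F"
  shows "weighted_solutions b (insert x F) n = weighted_solutions b F n \<union>
    (if b x \<le> n then (\<lambda>u. u(x := Suc (u x))) ` weighted_solutions b (insert x F) (n - b x) else {})"
    (is "?L = ?R")
proof -
  have upd: "(\<Sum>i\<in>F. b i * (u(x := m)) i) = (\<Sum>i\<in>F. b i * u i)" for u m
    using x by (intro sum.cong) auto
  show ?thesis
  proof (intro equalityI subsetI)
    fix u assume u: "u \<in> ?L"
    show "u \<in> ?R"
    proof (cases "u x")
      case 0
      have "u i = 0" if "i \<notin> F" for i
        using u 0 that by (cases "i = x") (auto simp: weighted_solutions_def)
      then show ?thesis using u 0 assms by (simp add: weighted_solutions_def)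
    next
      case (Suc m)
      have n: "b x * Suc m + (\<Sum>i\<in>F. b i * u i) = n"
        using u assms Suc by (simp add: weighted_solutions_def)
      then have "b x \<le> n" by auto
      have "u(x := m) \<in> weighted_solutions b (insert x F) (n - b x)"
        using u assms n upd[of u m] by (auto simp: weighted_solutions_def)
      moreover have "u = (u(x := m))(x := Suc ((u(x := m)) x))" using Suc by auto
      ultimately have "u \<in> (\<lambda>u. u(x := Suc (u x))) ` weighted_solutions b (insert x F) (n - b x)"
        by (intro image_eqI)
      then show ?thesis using \<open>b x \<le> n\<close> by simp
    qed
  next
    fix u assume "u \<in> ?R"
    then show "u \<in> ?L"
      using assms upd by (auto simp: weighted_solutions_def split: if_splits)
  qed
qed

text \<open>Raising the entry at \<open>x\<close> is injective and leaves it positive, whereas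
  solutions over \<open>F\<close> vanish at \<open>x\<close>; so the two pieces of the decomposition
  are disjoint and their sizes add. This is the coefficientwise form of multiplying a generating
  function by \<open>1 - fps_X ^ b x\<close>.\<close>

lemma card_weighted_solutions_insert:
  assumes F: "finite F" and x: "x \<notin> F" and pos: "\<And>i. i \<in> insert x F \<Longrightarrow> b i > 0"
  shows "card (weighted_solutions b (insert x F) n) = card (weighted_solutions b F n) +
    (if b x \<le> n then card (weighted_solutions b (insert x F) (n - b x)) else 0)"
proof -
  let ?f = "\<lambda>u. u(x := Suc (u x))"
  let ?S = "weighted_solutions b (insert x F) (n - b x)"
  have fin: "finite (weighted_solutions b F n)" "finite ?S"
    using F pos by (auto intro!: finite_weighted_solutions)
  have "inj_on ?f ?S"
    by (rule inj_on_inverseI[where g = "\<lambda>u. u(x := u x - 1)"]) auto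
  then have card: "card (?f ` ?S) = card ?S" by (rule card_image)
  have disj: "weighted_solutions b F n \<inter> ?f ` ?S = {}"
    using x by (auto simp: weighted_solutions_def)
  show ?thesis
    unfolding weighted_solutions_insert[OF F x, of b n]
    using fin card disj by (auto simp: card_Un_disjoint)
qed

lemma fps_card_weighted_solutions:
  assumes "finite I" and "\<And>i. i \<in> I \<Longrightarrow> b i > 0"
  shows "Abs_fps (\<lambda>n. of_nat (card (weighted_solutions b I n))) =
    (\<Prod>i\<in>I. 1 / (1 - fps_X ^ b i) :: 'a::field fps)"
  using assms
proof (induction I rule: finite_induct)
  case empty
  have "weighted_solutions b {} n = (if n = 0 then {\<lambda>_. 0} else {})" for n
    by (auto simp: weighted_solutions_def)
  then show ?case by (auto simp: fps_eq_iff)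
next
  case (insert x F)
  let ?G = "\<lambda>I. Abs_fps (\<lambda>n. of_nat (card (weighted_solutions b I n))) :: 'a fps"
  let ?d = "1 - fps_X ^ b x :: 'a fps"
  \<comment> \<open>Since \<open>b x > 0\<close>, the constant term is 1 and \<open>?d\<close> is a
    unit; for \<open>b x = 0\<close> it would be the zero series.\<close>
  have d: "fps_nth ?d 0 \<noteq> 0" using insert.prems[of x] by simp
  \<comment> \<open>The factor \<open>?d\<close> subtracts the coefficient at \<open>n - b x\<close>
    from the one at \<open>n\<close>, and by the recurrence only the solutions vanishing at
    \<open>x\<close> remain.\<close>
  have G: "?G (insert x F) * ?d = ?G F"
  proof (rule fps_ext)
    fix n
    show "fps_nth (?G (insert x F) * ?d) n = fps_nth (?G F) n"
      using card_weighted_solutions_insert[OF insert.hyps insert.prems, where n = n]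
      by (auto simp: right_diff_distrib fps_X_power_mult_right_nth)
  qed
  have "?G (insert x F) = ?G (insert x F) * (?d * inverse ?d)"
    using inverse_mult_eq_1'[OF d] by simp
  also have "\<dots> = ?G F * inverse ?d" unfolding G[symmetric] by (rule mult.assoc[symmetric])
  also have "\<dots> = ?G F * (1 / ?d)" using d by (simp add: fps_divide_unit)
  finally show ?case using insert by (simp add: mult.commute)
qed

lemma weight_mult_mat_vec:
  fixes B :: "'a::comm_semiring_0 mat"
  assumes "B \<in> carrier_mat m k" "u \<in> carrier_vec k"
  shows "weight (B *\<^sub>v u) = (\<Sum>i<k. col_sum B i * u $ i)"
proof -
  have "weight (B *\<^sub>v u) = (\<Sum>i<m. \<Sum>j<k. B $$ (i, j) * u $ j)"
    using assms by (auto simp: weight_def scalar_prod_def atLeast0LessThan)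
  also have "\<dots> = (\<Sum>j<k. \<Sum>i<m. B $$ (i, j) * u $ j)" by (rule sum.swap)
  also have "\<dots> = (\<Sum>i<k. col_sum B i * u $ i)"
    using assms by (simp add: col_sum_def sum_distrib_right)
  finally show ?thesis .
qed

text \<open>Strict triangularity kills the terms of row \<open>i\<close> of
  \<open>A *\<^sub>v v\<close> with index at most \<open>i\<close>, so the sum over later indices in
  each defining inequality is a full row product.\<close>

lemma P_set_eq:
  assumes A: "A \<in> carrier_mat k k" and ut: "strictly_upper_triangular A"
  shows "P_set k A = {v \<in> carrier_vec k. \<forall>i<k. ((1\<^sub>m k - A) *\<^sub>v v) $ i \<ge> 0}"
proof -
  have "((1\<^sub>m k - A) *\<^sub>v v) $ i = v $ i - (\<Sum>j\<in>{i<..<k}. A $$ (i, j) * v $ j)"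
    if v: "v \<in> carrier_vec k" and i: "i < k" for v i
  proof -
    have "(A *\<^sub>v v) $ i = (\<Sum>j<k. A $$ (i, j) * v $ j)"
      using A v i by (auto simp: scalar_prod_def atLeast0LessThan)
    also have "\<dots> = (\<Sum>j\<in>{i<..<k}. A $$ (i, j) * v $ j)"
      using A ut i by (intro sum.mono_neutral_right) (auto simp: strictly_upper_triangular_def)
    finally show ?thesis
      using A v i by (simp add: minus_mult_distrib_mat_vec[of _ k k])
  qed
  then show ?thesis by (auto simp: P_set_def)
qed

theorem theorem1:
  fixes k :: nat and A :: "int mat"
  defines "B \<equiv> inv_mat (1\<^sub>m k - A)"
  assumes "k \<ge> 1"
    and "A \<in> carrier_mat k k"
    and "strictly_upper_triangular A"
    and "\<forall>v \<in> P_set k A. \<forall>i<k. v $ i \<ge> 0"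
  shows "(\<forall>n. finite (P_weight_set k A n)) \<and>
         (\<forall>i<k. col_sum B i > 0) \<and>
         Abs_fps (\<lambda>n. of_nat (card (P_weight_set k A n))) =
           (\<Prod>i<k. 1 / (1 - fps_X ^ nat (col_sum B i)) :: rat fps)"
proof -
  note A = assms(3,4)
  define M where "M = 1\<^sub>m k - A"
  have M: "M \<in> carrier_mat k k" using A(1) unfolding M_def by (rule minus_carrier_mat)
  note inv = inv_mat_one_minus_strictly_upper_triangular[OF A, folded B_def M_def]
  have MB: "M *\<^sub>v (B *\<^sub>v u) = u" and BM: "B *\<^sub>v (M *\<^sub>v u) = u" if "u \<in> carrier_vec k" for u
    using that M inv by (simp_all flip: assoc_mult_mat_vec)
  have P: "P_set k A = {v \<in> carrier_vec k. \<forall>i<k. (M *\<^sub>v v) $ i \<ge> 0}"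
    using P_set_eq[OF A] unfolding M_def .
  have pos: "col_sum B i > 0" if i: "i < k" for i
  proof -
    let ?v = "B *\<^sub>v unit_vec k i"
    have v: "?v \<in> carrier_vec k" using inv(1) by simp
    have "?v \<in> P_set k A" using v i by (auto simp: P MB)
    then have nonneg: "?v $ j \<ge> 0" if "j < k" for j using assms(5) that by blast
    have "weight ?v = (\<Sum>j<k. col_sum B j * unit_vec k i $ j)"
      using inv(1) by (rule weight_mult_mat_vec) simp
    also have "\<dots> = (\<Sum>j<k. if j = i then col_sum B j else 0)"
      using i by (intro sum.cong) auto
    also have "\<dots> = col_sum B i" using i by simp
    finally have "col_sum B i = (\<Sum>j<k. ?v $ j)" unfolding weight_def carrier_vecD[OF v] ..
    \<comment> \<open>A vanishing sum of nonnegative entries would make column \<open>i\<close> of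
      \<open>B\<close> zero, and applying \<open>M\<close> would then turn the unit vector into
      zero.\<close>
    moreover have "(\<Sum>j<k. ?v $ j) \<noteq> 0"
    proof
      assume "(\<Sum>j<k. ?v $ j) = 0"
      then have "\<forall>j\<in>{..<k}. ?v $ j = 0"
        using nonneg by (subst (asm) sum_nonneg_eq_0_iff) auto
      then have "?v = 0\<^sub>v k" using inv(1) by (intro eq_vecI) auto
      then have "unit_vec k i = M *\<^sub>v 0\<^sub>v k" using MB[of "unit_vec k i"] by simp
      also have "\<dots> = 0\<^sub>v k" using M by (intro eq_vecI) auto
      finally have "unit_vec k i $ i = (0\<^sub>v k $ i :: int)" by simp
      then show False using i by simp
    qed
    moreover have "(\<Sum>j<k. ?v $ j) \<ge> 0" using nonneg by (intro sum_nonneg) auto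
    ultimately show ?thesis by simp
  qed
  define b where "b i = nat (col_sum B i)" for i
  define \<phi> :: "(nat \<Rightarrow> nat) \<Rightarrow> int vec" where "\<phi> u = B *\<^sub>v vec k (\<lambda>i. int (u i))" for u
  \<comment> \<open>On \<open>P_set k A\<close> the entries of \<open>M *\<^sub>v v\<close> are
    nonnegative, so \<open>nat\<close> loses nothing there; the value 0 from index \<open>k\<close>
    on matches the support condition of \<open>weighted_solutions\<close>.\<close>
  define \<psi> :: "int vec \<Rightarrow> nat \<Rightarrow> nat"
    where "\<psi> v i = (if i < k then nat ((M *\<^sub>v v) $ i) else 0)" for v i
  have \<phi>P: "\<phi> u \<in> P_set k A" for u using inv(1) by (auto simp: P \<phi>_def MB)
  \<comment> \<open>Positivity of the column sums gives \<open>int (b i) = col_sum B i\<close>,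
    which turns the integer weight formula into one over the naturals.\<close>
  have weight: "weight (\<phi> u) = int (\<Sum>i<k. b i * u i)" for u
    using weight_mult_mat_vec[OF inv(1), of "vec k (\<lambda>i. int (u i))"] pos
    by (simp add: \<phi>_def b_def less_imp_le)
  have \<phi>\<psi>: "\<phi> (\<psi> v) = v" if v: "v \<in> P_set k A" for v
  proof -
    have "vec k (\<lambda>i. int (\<psi> v i)) = M *\<^sub>v v" using v M by (intro eq_vecI) (auto simp: P \<psi>_def)
    then show ?thesis using v by (simp add: \<phi>_def BM P)
  qed
  have bij: "bij_betw \<phi> (weighted_solutions b {..<k} n) (P_weight_set k A n)" for n
  proof (rule bij_betw_byWitness[where f' = \<psi>])
    show "\<forall>u\<in>weighted_solutions b {..<k} n. \<psi> (\<phi> u) = u"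
      by (auto simp: \<psi>_def \<phi>_def MB weighted_solutions_def fun_eq_iff)
    show "\<forall>v\<in>P_weight_set k A n. \<phi> (\<psi> v) = v" using \<phi>\<psi> by (auto simp: P_weight_set_def)
    show "\<phi> ` weighted_solutions b {..<k} n \<subseteq> P_weight_set k A n"
      using \<phi>P weight by (auto simp: P_weight_set_def weighted_solutions_def)
    show "\<psi> ` P_weight_set k A n \<subseteq> weighted_solutions b {..<k} n"
    proof (rule image_subsetI)
      fix v assume "v \<in> P_weight_set k A n"
      \<comment> \<open>The weight formula applies to \<open>v\<close> after writing it as
        \<open>\<phi> (\<psi> v)\<close>.\<close>
      then have "int (\<Sum>i<k. b i * \<psi> v i) = int n"
        using weight[of "\<psi> v"] \<phi>\<psi>[of v] by (simp add: P_weight_set_def)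
      then have "(\<Sum>i<k. b i * \<psi> v i) = n" by (simp only: of_nat_eq_iff)
      then show "\<psi> v \<in> weighted_solutions b {..<k} n"
        by (simp add: weighted_solutions_def \<psi>_def)
    qed
  qed
  have b_pos: "b i > 0" if "i \<in> {..<k}" for i using pos that by (simp add: b_def)
  have "finite (P_weight_set k A n)" for n
    using finite_weighted_solutions[of "{..<k}" b n, OF _ b_pos] bij_betw_finite[OF bij] by simp
  moreover have "Abs_fps (\<lambda>n. of_nat (card (P_weight_set k A n))) =
      (\<Prod>i<k. 1 / (1 - fps_X ^ b i) :: rat fps)"
    using fps_card_weighted_solutions[of "{..<k}" b, OF _ b_pos] bij_betw_same_card[OF bij] by simp
  ultimately show ?thesis using pos by (simp add: b_def)
qed

end
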